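(* Let $\theta$ be an ergodic aperiodic measure preserving transformation of a probability space $(X,\Sigma,\mu)$ and denote $Tf=f\circ\theta$. Then for every $0<r<1$ there exists $f\in\overline{(I-T)L^r(\mu)}$ (closure in the $L^r$ metric) such that the averages $\frac1n\sum_{k=0}^{n-1}T^kf$ do not converge in the $L^r$ metric as $n\to\infty$.
   Context: For $0<r<1$, $L^r(\mu)=\{f \text{ measurable}:\int|f|^r d\mu<\infty\}$ (modulo a.e. equality) is a vector space with the complete invariant metric $d(f,g)=\int|f-g|^r d\mu$, called the $L^r$ metric. $(I-T)L^r(\mu)=\{g-Tg: g\in L^r(\mu)\}$. Aperiodic means: for every $n\ge1$ and every $A\in\Sigma$ with $\mu(A)>0$ there is $B\in\Sigma$ with $B\subset A$, $\mu(B)>0$ and $\mu(B\cap\theta^{-n}B)=0$ (on a Lebesgue space this is equivalent to: the set of $x$ with $\theta^n x=x$ for some $n\ge1$ has measure zero). *)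

theory Defs
  imports "HOL-Probability.Probability"
begin

definition measure_preserving :: "'a measure \<Rightarrow> ('a \<Rightarrow> 'a) \<Rightarrow> bool" where
  "measure_preserving M \<theta> \<longleftrightarrow>
     \<theta> \<in> measurable M M \<and>
     (\<forall>A\<in>sets M. emeasure M (\<theta> -` A \<inter> space M) = emeasure M A)"

definition ergodic :: "'a measure \<Rightarrow> ('a \<Rightarrow> 'a) \<Rightarrow> bool" where
  "ergodic M \<theta> \<longleftrightarrow>
     (\<forall>A\<in>sets M. \<theta> -` A \<inter> space M = A \<longrightarrow>
        emeasure M A = 0 \<or> emeasure M (space M - A) = 0)"

definition aperiodic :: "'a measure \<Rightarrow> ('a \<Rightarrow> 'a) \<Rightarrow> bool" where
  "aperiodic M \<theta> \<longleftrightarrow>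
     (\<forall>n\<ge>1. \<forall>A\<in>sets M. emeasure M A > 0 \<longrightarrow>
        (\<exists>B\<in>sets M. B \<subseteq> A \<and> emeasure M B > 0 \<and>
           emeasure M (B \<inter> ((\<theta> ^^ n) -` B \<inter> space M)) = 0))"

text \<open>
  Elements of \<open>L\<^sup>r\<close> are represented by real-valued functions, and \<open>Lr_dist\<close> is a pseudometric on
  these representatives whose zero distances are exactly the almost everywhere equalities.
  Its values are meaningful only for arguments in \<open>Lr\<close>: the Bochner integral of a
  non-integrable function is 0.
\<close>

definition Lr :: "'a measure \<Rightarrow> real \<Rightarrow> ('a \<Rightarrow> real) set" where
  "Lr M r = {f \<in> borel_measurable M. integrable M (\<lambda>x. \<bar>f x\<bar> powr r)}"

definition Lr_dist :: "'a measure \<Rightarrow> real \<Rightarrow> ('a \<Rightarrow> real) \<Rightarrow> ('a \<Rightarrow> real) \<Rightarrow> real" where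
  "Lr_dist M r f g = (\<integral>x. \<bar>f x - g x\<bar> powr r \<partial>M)"

definition Lr_closure :: "'a measure \<Rightarrow> real \<Rightarrow> ('a \<Rightarrow> real) set \<Rightarrow> ('a \<Rightarrow> real) set" where
  "Lr_closure M r S = {f \<in> Lr M r. \<forall>\<epsilon>>0. \<exists>h\<in>S \<inter> Lr M r. Lr_dist M r f h < \<epsilon>}"

definition Lr_convergent :: "'a measure \<Rightarrow> real \<Rightarrow> (nat \<Rightarrow> 'a \<Rightarrow> real) \<Rightarrow> bool" where
  "Lr_convergent M r F \<longleftrightarrow> (\<exists>h\<in>Lr M r. (\<lambda>n. Lr_dist M r (F n) h) \<longlonglongrightarrow> 0)"

definition koopman :: "('a \<Rightarrow> 'a) \<Rightarrow> ('a \<Rightarrow> real) \<Rightarrow> ('a \<Rightarrow> real)" where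
  "koopman \<theta> f = f \<circ> \<theta>"

definition coboundaries :: "'a measure \<Rightarrow> ('a \<Rightarrow> 'a) \<Rightarrow> real \<Rightarrow> ('a \<Rightarrow> real) set" where
  "coboundaries M \<theta> r = (\<lambda>g x. g x - koopman \<theta> g x) ` Lr M r"

definition ergodic_average :: "('a \<Rightarrow> 'a) \<Rightarrow> ('a \<Rightarrow> real) \<Rightarrow> nat \<Rightarrow> 'a \<Rightarrow> real" where
  "ergodic_average \<theta> f n x = 1 / real n * (\<Sum>k<n. (koopman \<theta> ^^ k) f x)"

end

theory Submission
  imports Defs
begin

text \<open>
  The obstruction is that for \<open>r < 1\<close> the constant function \<open>1\<close> is an \<open>L\<^sup>r\<close> limit of coboundaries,
  although its averages are \<open>1\<close>, while the averages of a coboundary tend to \<open>0\<close>.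

  To approximate \<open>1\<close>, take a set \<open>B\<close> of small positive measure, which exists by aperiodicity, and
  let \<open>g\<close> be the time needed to reach \<open>B\<close>, cut off at a large \<open>N\<close>. The time to reach \<open>B\<close> drops by one
  along an orbit until \<open>B\<close> is hit, so the error \<open>u = 1 - (g - g \<circ> \<theta>)\<close> is nonnegative and lives on \<open>B\<close>,
  up to the points that stay off \<open>B\<close> until time \<open>N\<close>; by ergodicity these have small measure.
  Since \<open>g\<close> is bounded, the coboundary has integral \<open>0\<close> and \<open>\<integral>u = 1\<close> (a truncated form of Kac's
  return time formula). So \<open>u\<close> has mass one concentrated on a small set, and as \<open>r < 1\<close> this
  makes \<open>\<integral>u\<^sup>r\<close> as small as desired. This is \<open>ergodic_aperiodic_imp_bounded_transfer\<close>.

  Now pick such errors \<open>u\<^sub>i = 1 - (g\<^sub>i - g\<^sub>i \<circ> \<theta>)\<close> with \<open>\<integral>u\<^sub>i\<^sup>r < (1/2)\<^sup>i\<close> and put \<open>f = \<Sum>u\<^sub>i\<close>, which is in \<open>L\<^sup>r\<close> by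
  \<open>Lr_suminf\<close>. Its partial sums are a constant minus a coboundary, hence limits of coboundaries,
  and so is \<open>f\<close>. On the other hand the sum over \<open>k < n\<close> of \<open>u\<^sub>i \<circ> \<theta>\<^sup>k\<close> telescopes to
  \<open>n - (g\<^sub>i - g\<^sub>i \<circ> \<theta>\<^sup>n)\<close>, so every average of \<open>u\<^sub>i\<close> over a long time is uniformly close to \<open>1\<close>. As all
  \<open>u\<^sub>i\<close> are nonnegative, the averages of \<open>f\<close> eventually exceed every \<open>K\<close> almost everywhere, which is
  incompatible with a limit in \<open>L\<^sup>r\<close> (\<open>not_Lr_convergent_if_eventually_ge\<close>).
\<close>

section \<open>The concave power\<close>

text \<open>
  After scaling to \<open>a + b = 1\<close> this is \<open>c \<le> c powr r\<close> for \<open>c\<close> in the unit interval, applied to \<open>a\<close> and \<open>b\<close>.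
\<close>

lemma powr_add_le_add_powr:
  fixes a b r :: real
  assumes "0 < r" "r \<le> 1" "0 \<le> a" "0 \<le> b"
  shows "(a + b) powr r \<le> a powr r + b powr r"
proof (cases "a + b = 0")
  case True
  then show ?thesis using assms by auto
next
  case False
  then have s: "a + b > 0" using assms by auto
  have *: "c / (a + b) \<le> (c / (a + b)) powr r" if "0 \<le> c" "c \<le> a + b" for c
    using powr_mono'[of r 1 "c / (a + b)"] that s assms by (auto simp: divide_simps)
  have "1 = a / (a + b) + b / (a + b)" using s by (simp add: add_divide_distrib[symmetric])
  also have "\<dots> \<le> (a / (a + b)) powr r + (b / (a + b)) powr r"
    using *[of a] *[of b] assms by auto
  also have "\<dots> = (a powr r + b powr r) / (a + b) powr r"
    using assms s by (simp add: powr_divide add_divide_distrib)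
  finally show ?thesis using s by (simp add: divide_simps)
qed

lemma abs_add_powr_le:
  fixes a b r :: real
  assumes "0 < r" "r \<le> 1"
  shows "\<bar>a + b\<bar> powr r \<le> \<bar>a\<bar> powr r + \<bar>b\<bar> powr r"
proof -
  have "\<bar>a + b\<bar> powr r \<le> (\<bar>a\<bar> + \<bar>b\<bar>) powr r"
    using assms by (intro powr_mono2) auto
  also have "\<dots> \<le> \<bar>a\<bar> powr r + \<bar>b\<bar> powr r"
    using assms by (intro powr_add_le_add_powr) auto
  finally show ?thesis .
qed

lemma sum_powr_le_sum_powr:
  fixes a :: "nat \<Rightarrow> real"
  assumes "0 < r" "r \<le> 1" "\<And>i. 0 \<le> a i"
  shows "(\<Sum>i<n. a i) powr r \<le> (\<Sum>i<n. a i powr r)"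
proof (induction n)
  case (Suc n)
  have "(\<Sum>i<Suc n. a i) powr r \<le> (\<Sum>i<n. a i) powr r + a n powr r"
    using assms by (auto intro!: powr_add_le_add_powr sum_nonneg)
  with Suc show ?case by simp
qed simp

text \<open>
  The terms tend to \<open>0\<close>, hence are eventually at most \<open>1\<close> and dominated by their \<open>r\<close>-th powers.
\<close>

lemma summable_powr_imp_summable:
  fixes a :: "nat \<Rightarrow> real"
  assumes "0 < r" "r \<le> 1" "\<And>i. 0 \<le> a i" "summable (\<lambda>i. a i powr r)"
  shows "summable a" "(\<Sum>i. a i) powr r \<le> (\<Sum>i. a i powr r)"
proof -
  have "eventually (\<lambda>i. a i powr r < 1) sequentially"
    using summable_LIMSEQ_zero[OF assms(4)] by (rule order_tendstoD) simp
  then have "eventually (\<lambda>i. norm (a i) \<le> a i powr r) sequentially"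
  proof eventually_elim
    case (elim i)
    have "a i \<le> 1"
    proof (rule ccontr)
      assume "\<not> a i \<le> 1"
      then have "1 \<le> a i powr r" using assms by (intro ge_one_powr_ge_zero) auto
      with elim show False by simp
    qed
    then show ?case using powr_mono'[of r 1 "a i"] assms by auto
  qed
  then show s: "summable a" by (rule summable_comparison_test_ev) fact
  have "(\<lambda>n. (\<Sum>i<n. a i) powr r) \<longlonglongrightarrow> (\<Sum>i. a i) powr r"
    using assms summable_LIMSEQ[OF s] by (intro tendsto_powr2) (auto intro!: always_eventually sum_nonneg)
  moreover have "(\<Sum>i<n. a i) powr r \<le> (\<Sum>i. a i powr r)" for n
    using sum_powr_le_sum_powr[of r a n] assms sum_le_suminf[OF assms(4), of "{..<n}"] by fastforce
  ultimately show "(\<Sum>i. a i) powr r \<le> (\<Sum>i. a i powr r)"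
    by (intro LIMSEQ_le_const2) auto
qed

text \<open>
  This bounds \<open>w powr r\<close> by the two cases \<open>w \<le> t\<close> and \<open>w \<ge> t\<close>. Integrated over a set of measure
  \<open>p\<close> with \<open>t = 1 / p\<close>, it replaces Hoelder's inequality: a nonnegative function with integral at most
  \<open>1\<close> has \<open>r\<close>-th power integral at most \<open>2 * p powr (1 - r)\<close> over that set.
\<close>

lemma powr_le_affine:
  fixes r t w :: real
  assumes "0 < r" "r < 1" "0 < t" "0 \<le> w"
  shows "w powr r \<le> t powr r + t powr (r - 1) * w"
proof (cases "w \<le> t")
  case True
  then have "w powr r \<le> t powr r" using assms by (intro powr_mono2) auto
  then show ?thesis using assms by (simp add: add_increasing2)
next
  case False
  then have "w powr r = w powr (r - 1) * w" using assms by (simp add: powr_diff)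
  also have "\<dots> \<le> t powr (r - 1) * w"
    using assms False by (intro mult_right_mono powr_mono2') auto
  finally show ?thesis by (simp add: add_increasing)
qed

section \<open>The space of r-integrable functions\<close>

lemma Lr_add:
  assumes "0 < r" "r \<le> 1" "f \<in> Lr M r" "g \<in> Lr M r"
  shows "(\<lambda>x. f x + g x) \<in> Lr M r"
proof -
  have [measurable]: "f \<in> borel_measurable M" "g \<in> borel_measurable M"
    using assms by (auto simp: Lr_def)
  have "integrable M (\<lambda>x. \<bar>f x\<bar> powr r + \<bar>g x\<bar> powr r)"
    using assms by (auto simp: Lr_def)
  then have "integrable M (\<lambda>x. \<bar>f x + g x\<bar> powr r)"
    by (rule Bochner_Integration.integrable_bound)
       (use abs_add_powr_le[OF assms(1,2)] in auto)
  then show ?thesis by (simp add: Lr_def)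
qed

lemma Lr_cmult:
  assumes "f \<in> Lr M r"
  shows "(\<lambda>x. c * f x) \<in> Lr M r"
  using assms by (auto simp: Lr_def abs_mult powr_mult)

lemma Lr_diff:
  assumes "0 < r" "r \<le> 1" "f \<in> Lr M r" "g \<in> Lr M r"
  shows "(\<lambda>x. f x - g x) \<in> Lr M r"
  using Lr_add[OF assms(1-3) Lr_cmult[OF assms(4), of "-1"]] by simp

lemma Lr_sum:
  assumes "0 < r" "r \<le> 1" "\<And>i. i < (n::nat) \<Longrightarrow> f i \<in> Lr M r"
  shows "(\<lambda>x. \<Sum>i<n. f i x) \<in> Lr M r"
  using assms(3)
proof (induction n)
  case 0
  then show ?case by (simp add: Lr_def)
next
  case (Suc n)
  then show ?case using Lr_add[OF assms(1,2), of "\<lambda>x. \<Sum>i<n. f i x" M "f n"] by simp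
qed

lemma (in finite_measure) bounded_imp_Lr:
  assumes "0 < r" "f \<in> borel_measurable M" "\<And>x. x \<in> space M \<Longrightarrow> \<bar>f x\<bar> \<le> c"
  shows "f \<in> Lr M r"
proof -
  have "integrable M (\<lambda>x. \<bar>f x\<bar> powr r)"
    using assms by (intro integrable_const_bound[of _ "c powr r"])
      (auto intro!: AE_I2 powr_mono2)
  then show ?thesis using assms by (simp add: Lr_def)
qed

text \<open>
  This is the form in which completeness of \<open>L\<^sup>r\<close> is used: the pointwise sum exists almost everywhere,
  because the series of the \<open>r\<close>-th powers has a finite integral. At the exceptional points \<open>suminf\<close> is
  an arbitrary value, so the nonnegativity of the sum also holds only almost everywhere.
\<close>

lemma Lr_suminf:
  assumes r: "0 < r" "r \<le> 1"
    and v: "\<And>i::nat. v i \<in> Lr M r" "\<And>i x. x \<in> space M \<Longrightarrow> 0 \<le> v i x"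
    and le: "\<And>i. (\<integral>x. v i x powr r \<partial>M) \<le> c i" and c: "summable c"
  shows "AE x in M. summable (\<lambda>i. v i x)"
    and "(\<lambda>x. \<Sum>i. v i x) \<in> Lr M r"
    and "(\<integral>x. \<bar>\<Sum>i. v i x\<bar> powr r \<partial>M) \<le> (\<Sum>i. c i)"
proof -
  have [measurable]: "v i \<in> borel_measurable M" for i
    using v(1)[of i] by (simp add: Lr_def)
  have int: "integrable M (\<lambda>x. v i x powr r)" for i
    using v(1)[of i] v(2) by (simp add: Lr_def cong: Bochner_Integration.integrable_cong)
  have sI: "summable (\<lambda>i. \<integral>x. v i x powr r \<partial>M)"
    using c le by (intro summable_comparison_test[OF _ c]) (auto simp: integral_nonneg)
  have "(\<integral>\<^sup>+x. (\<Sum>i. ennreal (v i x powr r)) \<partial>M) = (\<Sum>i. ennreal (\<integral>x. v i x powr r \<partial>M))"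
    by (subst nn_integral_suminf) (auto simp: nn_integral_eq_integral[OF int])
  also have "\<dots> = ennreal (\<Sum>i. \<integral>x. v i x powr r \<partial>M)"
    using sI by (intro suminf_ennreal2) (auto simp: integral_nonneg)
  finally have eq: "(\<integral>\<^sup>+x. (\<Sum>i. ennreal (v i x powr r)) \<partial>M) = ennreal (\<Sum>i. \<integral>x. v i x powr r \<partial>M)" .
  have "AE x in M. (\<Sum>i. ennreal (v i x powr r)) \<noteq> \<infinity>"
    by (intro nn_integral_PInf_AE) (auto simp: eq)
  then have AEs: "AE x in M. summable (\<lambda>i. v i x powr r)"
    by eventually_elim (rule summable_suminf_not_top, auto)
  with AE_space show "AE x in M. summable (\<lambda>i. v i x)"
    by eventually_elim (use summable_powr_imp_summable(1)[OF r] v in auto)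
  have AEle: "AE x in M. \<bar>\<Sum>i. v i x\<bar> powr r \<le> (\<Sum>i. v i x powr r)"
    using AE_space AEs
  proof eventually_elim
    case (elim x)
    note s = summable_powr_imp_summable[OF r _ elim(2)]
    have "0 \<le> (\<Sum>i. v i x)" using elim v by (intro suminf_nonneg s) auto
    then show ?case using s(2) v elim by auto
  qed
  have intS: "integrable M (\<lambda>x. \<Sum>i. v i x powr r)"
    using int AEs sI by (intro integrable_suminf) auto
  have intf: "integrable M (\<lambda>x. \<bar>\<Sum>i. v i x\<bar> powr r)"
    by (rule Bochner_Integration.integrable_bound[OF intS])
       (use AEle in \<open>auto elim!: eventually_mono\<close>)
  then show "(\<lambda>x. \<Sum>i. v i x) \<in> Lr M r" by (simp add: Lr_def)
  have "(\<integral>x. \<bar>\<Sum>i. v i x\<bar> powr r \<partial>M) \<le> (\<integral>x. (\<Sum>i. v i x powr r) \<partial>M)"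
    by (intro integral_mono_AE intf intS AEle)
  also have "\<dots> = (\<Sum>i. \<integral>x. v i x powr r \<partial>M)"
    using int AEs sI by (intro integral_suminf) auto
  also have "\<dots> \<le> (\<Sum>i. c i)" by (intro suminf_le le sI c)
  finally show "(\<integral>x. \<bar>\<Sum>i. v i x\<bar> powr r \<partial>M) \<le> (\<Sum>i. c i)" .
qed

text \<open>
  If \<open>F n \<ge> K\<close> almost everywhere, then \<open>K powr r\<close> is at most the distance of \<open>F n\<close> to \<open>h\<close> plus \<open>\<integral>\<bar>h\<bar> powr r\<close>. In the
  limit this bounds all \<open>K\<close> by a constant that depends only on \<open>h\<close>.
\<close>

lemma (in prob_space) not_Lr_convergent_if_eventually_ge:
  assumes r: "0 < r" "r \<le> 1" and F: "\<And>n. F n \<in> Lr M r"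
    and ge: "\<And>K::nat. eventually (\<lambda>n. AE x in M. real K \<le> F n x) sequentially"
  shows "\<not> Lr_convergent M r F"
proof
  assume "Lr_convergent M r F"
  then obtain h where h: "h \<in> Lr M r" and lim: "(\<lambda>n. Lr_dist M r (F n) h) \<longlonglongrightarrow> 0"
    by (auto simp: Lr_convergent_def)
  define c where "c = (\<integral>x. \<bar>h x\<bar> powr r \<partial>M)"
  have c0: "0 \<le> c" by (simp add: c_def integral_nonneg)
  define K where "K = nat \<lceil>(c + 1) powr (1 / r)\<rceil>"
  have "((c + 1) powr (1 / r)) powr r \<le> real K powr r"
    unfolding K_def using r by (intro powr_mono2) auto
  then have K: "c + 1 \<le> real K powr r" using r c0 by (simp add: powr_powr)
  have "eventually (\<lambda>n. Lr_dist M r (F n) h < 1) sequentially"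
    using lim by (rule order_tendstoD) simp
  with ge[of K] have "eventually (\<lambda>n. (AE x in M. real K \<le> F n x) \<and> Lr_dist M r (F n) h < 1) sequentially"
    by eventually_elim auto
  then obtain n where n: "AE x in M. real K \<le> F n x" "Lr_dist M r (F n) h < 1"
    by (auto simp: eventually_sequentially)
  have int: "integrable M (\<lambda>x. \<bar>F n x - h x\<bar> powr r)" "integrable M (\<lambda>x. \<bar>h x\<bar> powr r)"
    using Lr_diff[OF r F[of n] h] h by (auto simp: Lr_def)
  have "real K powr r = (\<integral>x. real K powr r \<partial>M)" by (simp add: prob_space)
  also have "\<dots> \<le> (\<integral>x. \<bar>F n x - h x\<bar> powr r + \<bar>h x\<bar> powr r \<partial>M)"
  proof (rule integral_mono_AE)
    show "AE x in M. real K powr r \<le> \<bar>F n x - h x\<bar> powr r + \<bar>h x\<bar> powr r"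
      using n(1)
    proof eventually_elim
      case (elim x)
      have "real K powr r \<le> \<bar>(F n x - h x) + h x\<bar> powr r"
        using elim r by (intro powr_mono2) auto
      also have "\<dots> \<le> \<bar>F n x - h x\<bar> powr r + \<bar>h x\<bar> powr r"
        by (rule abs_add_powr_le[OF r])
      finally show ?case .
    qed
  qed (use int in auto)
  also have "\<dots> = Lr_dist M r (F n) h + c"
    using int by (simp add: Lr_dist_def c_def)
  finally show False using K n(2) by simp
qed

section \<open>Measure preserving systems\<close>

locale measure_preserving_system = prob_space M for M :: "'a measure" +
  fixes \<theta> :: "'a \<Rightarrow> 'a"
  assumes preserving: "measure_preserving M \<theta>"
begin

lemma measurable_theta [measurable]: "\<theta> \<in> measurable M M"
  using preserving by (simp add: measure_preserving_def)

lemma iterate_in_space: "x \<in> space M \<Longrightarrow> (\<theta> ^^ n) x \<in> space M"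
  by (rule measurable_space[OF measurable_compose_n[OF measurable_theta]])

lemma distr_iterate: "distr M M (\<theta> ^^ n) = M"
proof (induction n)
  case 0
  have "distr M M (\<lambda>x. x) = M" by (rule distr_id2) simp
  then show ?case by (simp add: id_def)
next
  case (Suc n)
  have 1: "distr M M \<theta> = M"
    using preserving by (intro measure_eqI) (auto simp: measure_preserving_def emeasure_distr)
  have "distr M M (\<theta> ^^ Suc n) = distr (distr M M (\<theta> ^^ n)) M \<theta>"
    by (subst distr_distr) auto
  then show ?case by (simp only: Suc 1)
qed

lemma measure_iterate_vimage:
  assumes "A \<in> sets M"
  shows "emeasure M ((\<theta> ^^ n) -` A \<inter> space M) = emeasure M A"
    and "measure M ((\<theta> ^^ n) -` A \<inter> space M) = measure M A"
proof -
  show "emeasure M ((\<theta> ^^ n) -` A \<inter> space M) = emeasure M A"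
    using emeasure_distr[of "\<theta> ^^ n" M M A] assms by (simp add: distr_iterate)
  then show "measure M ((\<theta> ^^ n) -` A \<inter> space M) = measure M A"
    by (simp add: measure_def)
qed

lemma AE_iterate:
  assumes "AE x in M. P x"
  shows "AE x in M. P ((\<theta> ^^ n) x)"
  by (rule AE_distrD[where M' = M]) (simp_all only: distr_iterate assms measurable_compose_n[OF measurable_theta])

lemma integral_iterate:
  fixes f :: "'a \<Rightarrow> real"
  assumes [measurable]: "f \<in> borel_measurable M"
  shows "(\<integral>x. f ((\<theta> ^^ n) x) \<partial>M) = (\<integral>x. f x \<partial>M)"
  using integral_distr[of "\<theta> ^^ n" M M f] by (simp add: distr_iterate)

lemma Lr_iterate:
  assumes "f \<in> Lr M r"
  shows "(\<lambda>x. f ((\<theta> ^^ n) x)) \<in> Lr M r"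
proof -
  have [measurable]: "f \<in> borel_measurable M" using assms by (simp add: Lr_def)
  show ?thesis
    using assms integrable_distr_eq[of "\<theta> ^^ n" M M "\<lambda>x. \<bar>f x\<bar> powr r"]
    by (simp add: Lr_def distr_iterate)
qed

section \<open>Small sets and recurrence\<close>

text \<open>
  Aperiodicity, used once for each time \<open>k \<le> n\<close> on a decreasing sequence of sets, gives a set of
  positive measure whose preimages up to time \<open>n\<close> are disjoint. There are \<open>n + 1\<close> of them,
  all of the same measure, and the total measure is \<open>1\<close>.
\<close>

lemma aperiodic_imp_small_set:
  assumes "aperiodic M \<theta>" "0 < \<delta>"
  shows "\<exists>C\<in>sets M. 0 < measure M C \<and> measure M C \<le> \<delta>"
proof -
  have ex: "\<exists>B\<in>sets M. 0 < emeasure M B \<and>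
      (\<forall>k\<in>{1..n}. emeasure M (B \<inter> ((\<theta> ^^ k) -` B \<inter> space M)) = 0)" for n
  proof (induction n)
    case 0
    show ?case by (intro bexI[of _ "space M"]) (auto simp: emeasure_space_1)
  next
    case (Suc n)
    then obtain A where A: "A \<in> sets M" "0 < emeasure M A"
      "\<And>k. k \<in> {1..n} \<Longrightarrow> emeasure M (A \<inter> ((\<theta> ^^ k) -` A \<inter> space M)) = 0" by blast
    obtain B where B: "B \<in> sets M" "B \<subseteq> A" "0 < emeasure M B"
      "emeasure M (B \<inter> ((\<theta> ^^ Suc n) -` B \<inter> space M)) = 0"
      using assms(1)[unfolded aperiodic_def, rule_format, of "Suc n", OF _ A(1,2)] by auto
    have "emeasure M (B \<inter> ((\<theta> ^^ k) -` B \<inter> space M)) = 0" if "k \<in> {1..Suc n}" for k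
    proof (cases "k = Suc n")
      case False
      then have "emeasure M (A \<inter> ((\<theta> ^^ k) -` A \<inter> space M)) = 0"
        using that by (intro A) auto
      moreover have "emeasure M (B \<inter> ((\<theta> ^^ k) -` B \<inter> space M))
          \<le> emeasure M (A \<inter> ((\<theta> ^^ k) -` A \<inter> space M))"
        using A B by (intro emeasure_mono sets.Int measurable_sets[of _ M M]) auto
      ultimately show ?thesis by simp
    qed (use B in simp)
    then show ?case using B by blast
  qed
  obtain n :: nat where n: "1 / \<delta> < n" using reals_Archimedean2 by blast
  obtain B where B: "B \<in> sets M" "0 < emeasure M B"
    "\<And>k. k \<in> {1..n} \<Longrightarrow> emeasure M (B \<inter> ((\<theta> ^^ k) -` B \<inter> space M)) = 0"
    using ex[of n] by blast
  \<comment> \<open>Removing the null set of points that return to \<open>B\<close> by time \<open>n\<close> makes the preimages disjoint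
    everywhere, not only up to null sets.\<close>
  define E where "E = (\<Union>k\<in>{1..n}. B \<inter> ((\<theta> ^^ k) -` B \<inter> space M))"
  have "E \<in> null_sets M"
    unfolding E_def using B
    by (intro null_sets_UN') (auto intro!: null_setsI sets.Int measurable_sets[of _ M M])
  define C where "C = B - E"
  have C: "C \<in> sets M" "emeasure M C = emeasure M B"
    using B \<open>E \<in> null_sets M\<close> by (auto simp: C_def emeasure_Diff_null_set)
  have disj: "disjoint_family_on (\<lambda>k. (\<theta> ^^ k) -` C \<inter> space M) {..n}"
  proof -
    have False if "i < j" "j \<le> n" "x \<in> space M" "(\<theta> ^^ i) x \<in> C" "(\<theta> ^^ j) x \<in> C" for i j x
    proof -
      have "(\<theta> ^^ j) x = (\<theta> ^^ (j - i)) ((\<theta> ^^ i) x)"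
        using that by (simp flip: funpow_add[THEN fun_cong, simplified])
      then have "(\<theta> ^^ i) x \<in> E"
        using that iterate_in_space[of x i] unfolding E_def C_def
        by (intro UN_I[of "j - i"]) auto
      then show False using that by (simp add: C_def)
    qed
    then show ?thesis
      unfolding disjoint_family_on_def by (auto, metis nat_neq_iff)
  qed
  have "real (Suc n) * measure M C = (\<Sum>k\<in>{..n}. measure M ((\<theta> ^^ k) -` C \<inter> space M))"
    using C by (simp add: measure_iterate_vimage)
  also have "\<dots> = measure M (\<Union>k\<in>{..n}. (\<theta> ^^ k) -` C \<inter> space M)"
    using C disj by (intro finite_measure_finite_Union[symmetric])
      (auto intro!: measurable_sets[of _ M M])
  also have "\<dots> \<le> 1" by (rule prob_le_1)
  finally have "measure M C \<le> 1 / real (Suc n)" by (simp add: field_simps)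
  also have "\<dots> \<le> \<delta>" using n assms(2) by (simp add: field_simps)
  finally show ?thesis
    using C B by (intro bexI[of _ C]) (auto simp: emeasure_eq_measure)
qed

text \<open>
  Ergodicity is applied to the set of points that visit \<open>B\<close> infinitely often, since it is invariant
  exactly and not only up to a null set. It has positive measure: the sets of points that visit
  \<open>B\<close> at some time \<open>\<ge> m\<close> decrease to it, and they all have the same measure, being iterated
  preimages of the set for \<open>m = 0\<close>.
\<close>

lemma ergodic_imp_measure_avoiding_tendsto_0:
  assumes "ergodic M \<theta>" and B[measurable]: "B \<in> sets M" and pos: "0 < measure M B"
  shows "(\<lambda>n. measure M {x \<in> space M. \<forall>k\<le>n. (\<theta> ^^ k) x \<notin> B}) \<longlonglongrightarrow> 0"
proof -
  define C where "C m = {x \<in> space M. \<exists>k\<ge>m. (\<theta> ^^ k) x \<in> B}" for m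
  have C[measurable]: "C m \<in> sets M" for m unfolding C_def by measurable
  define I where "I = (\<Inter>m. C m)"
  have I[measurable]: "I \<in> sets M" unfolding I_def by measurable
  have vim: "(\<theta> ^^ m) -` C 0 \<inter> space M = C m" for m
  proof -
    have "(\<exists>k. (\<theta> ^^ k) ((\<theta> ^^ m) x) \<in> B) \<longleftrightarrow> (\<exists>k\<ge>m. (\<theta> ^^ k) x \<in> B)" for x
      by (metis comp_apply funpow_add le_add2 le_add_diff_inverse2)
    then show ?thesis using iterate_in_space by (auto simp: C_def)
  qed
  have "(\<lambda>m. measure M (C m)) \<longlonglongrightarrow> measure M I"
    unfolding I_def
    by (rule finite_Lim_measure_decseq) (auto simp: decseq_def C_def intro: order_trans)
  moreover have "(\<lambda>m. measure M (C m)) = (\<lambda>m. measure M (C 0))"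
    by (rule ext) (rule measure_iterate_vimage(2)[OF C, of _ 0, unfolded vim])
  ultimately have "measure M I = measure M (C 0)" by (simp add: LIMSEQ_const_iff)
  moreover have "measure M B \<le> measure M (C 0)"
    using sets.sets_into_space[OF B]
    by (intro finite_measure_mono) (auto simp: C_def intro!: exI[of _ 0])
  ultimately have "emeasure M I \<noteq> 0" using pos by (simp add: emeasure_eq_measure)
  moreover have "\<theta> -` I \<inter> space M = I"
  proof -
    have "(\<forall>m. \<exists>k\<ge>m. (\<theta> ^^ k) (\<theta> x) \<in> B) \<longleftrightarrow> (\<forall>m. \<exists>k\<ge>m. (\<theta> ^^ k) x \<in> B)" for x
    proof -
      have *: "(\<theta> ^^ k) (\<theta> x) = (\<theta> ^^ Suc k) x" for k by (simp add: funpow_swap1)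
      show ?thesis unfolding * by (metis Suc_le_D Suc_le_mono le_SucI)
    qed
    then show ?thesis using iterate_in_space[of _ 1] by (auto simp: I_def C_def)
  qed
  ultimately have "emeasure M (space M - I) = 0"
    using assms(1) I unfolding ergodic_def by blast
  define D where "D n = {x \<in> space M. \<forall>k\<le>n. (\<theta> ^^ k) x \<notin> B}" for n
  have D[measurable]: "D m \<in> sets M" for m unfolding D_def by measurable
  have "(\<lambda>m. measure M (D m)) \<longlonglongrightarrow> measure M (\<Inter>m. D m)"
    by (rule finite_Lim_measure_decseq) (auto simp: decseq_def D_def)
  moreover have "measure M (\<Inter>m. D m) \<le> measure M (space M - I)"
    by (intro finite_measure_mono) (auto simp: D_def I_def C_def, blast)
  ultimately show ?thesis
    using \<open>emeasure M (space M - I) = 0\<close>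
    by (simp add: D_def emeasure_eq_measure measure_le_0_iff)
qed

section \<open>Approximating the constant one by coboundaries\<close>

text \<open>
  The time to reach \<open>B\<close> need not be in \<open>L\<^sup>r\<close>, which is why it is cut off. Boundedness also makes
  \<open>g\<close> integrable, so that \<open>1 - (g - g \<circ> \<theta>)\<close> has integral \<open>1\<close>, and it makes the averages of the
  coboundary tend to \<open>0\<close> uniformly.
\<close>

lemma ergodic_aperiodic_imp_bounded_transfer:
  fixes r \<epsilon> :: real
  assumes "ergodic M \<theta>" "aperiodic M \<theta>" "0 < r" "r < 1" "0 < \<epsilon>"
  shows "\<exists>(g :: 'a \<Rightarrow> real) L. g \<in> borel_measurable M \<and> (\<forall>x. 0 \<le> g x \<and> g x \<le> L) \<and>
    (\<forall>x\<in>space M. 0 \<le> 1 - (g x - g (\<theta> x))) \<and>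
    (\<integral>x. (1 - (g x - g (\<theta> x))) powr r \<partial>M) < \<epsilon>"
proof -
  \<comment> \<open>The error on \<open>B\<close> will be at most \<open>2 * p powr (1 - r)\<close>, where \<open>p\<close> is the measure of \<open>B\<close>.\<close>
  define \<delta> where "\<delta> = (\<epsilon> / 8) powr (1 / (1 - r))"
  have "0 < \<delta>" using assms by (simp add: \<delta>_def)
  then obtain B where B[measurable]: "B \<in> sets M" "0 < measure M B" "measure M B \<le> \<delta>"
    using aperiodic_imp_small_set[OF assms(2)] by blast
  define p where "p = measure M B"
  have "p powr (1 - r) \<le> \<delta> powr (1 - r)"
    using B assms by (intro powr_mono2) (auto simp: p_def)
  also have "\<dots> = \<epsilon> / 8" using assms by (simp add: \<delta>_def powr_powr)
  finally have p: "p powr (1 - r) \<le> \<epsilon> / 8" "0 < p" using B by (auto simp: p_def)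
  define D where "D n = {x \<in> space M. \<forall>k\<le>n. (\<theta> ^^ k) x \<notin> B}" for n
  have D[measurable]: "D n \<in> sets M" for n unfolding D_def by measurable
  have "eventually (\<lambda>n. measure M (D n) < \<epsilon> / 2) sequentially"
    using ergodic_imp_measure_avoiding_tendsto_0[OF assms(1) B(1,2)] assms(5)
    unfolding D_def by (intro order_tendstoD) auto
  then obtain N where N: "measure M (D N) < \<epsilon> / 2"
    by (auto simp: eventually_sequentially)
  \<comment> \<open>The first time of a visit to \<open>B\<close>, cut off at \<open>N\<close>: the orbit is in \<open>D j\<close> for all \<open>j\<close> before it.\<close>
  define g :: "'a \<Rightarrow> real" where "g x = (\<Sum>j<N. indicator (D j) x)" for x
  have g[measurable]: "g \<in> borel_measurable M" unfolding g_def by measurable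
  have g0: "0 \<le> g x" for x by (auto simp: g_def intro!: sum_nonneg)
  have gN: "g x \<le> N" for x
    using sum_bounded_above[of "{..<N}" "\<lambda>j. indicator (D j) x :: real" 1]
    by (auto simp: g_def indicator_def)
  define u where "u x = 1 - (g x - g (\<theta> x))" for x
  have u[measurable]: "u \<in> borel_measurable M" unfolding u_def by measurable
  have uB: "u x = 1 + g (\<theta> x)" if "x \<in> B" for x
  proof -
    have "x \<notin> D j" for j using that by (auto simp: D_def intro!: exI[of _ 0])
    then show ?thesis by (simp add: u_def g_def)
  qed
  have unB: "u x = indicator (D N) x" if "x \<in> space M" "x \<notin> B" for x
  proof -
    have "\<theta> x \<in> D j \<longleftrightarrow> x \<in> D (Suc j)" for j
    proof -
      have "(\<forall>k\<le>Suc j. (\<theta> ^^ k) x \<notin> B) \<longleftrightarrow> (\<forall>k\<le>j. (\<theta> ^^ k) (\<theta> x) \<notin> B)"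
        using that(2) All_less_Suc2[of "Suc j" "\<lambda>k. (\<theta> ^^ k) x \<notin> B"]
        by (simp add: less_Suc_eq_le funpow_swap1)
      then show ?thesis
        using that iterate_in_space[of x 1] by (simp add: D_def)
    qed
    then have "g (\<theta> x) - g x = (\<Sum>j<N. indicator (D (Suc j)) x - indicator (D j) x)"
      by (simp add: g_def sum_subtractf indicator_def)
    also have "\<dots> = indicator (D N) x - indicator (D 0) x"
      by (rule sum_lessThan_telescope)
    also have "indicator (D 0) x = (1 :: real)" using that by (simp add: D_def)
    finally show ?thesis by (simp add: u_def)
  qed
  have u0: "0 \<le> u x" if "x \<in> space M" for x
    using uB[of x] unB[of x] that g0[of "\<theta> x"] by (cases "x \<in> B") auto
  have intg: "integrable M g"
    using g0 gN by (intro integrable_const_bound[of _ N]) auto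
  have intg': "integrable M (\<lambda>x. g (\<theta> x))"
    using g0 gN by (intro integrable_const_bound[of _ N]) auto
  have intu: "integrable M u" unfolding u_def using intg intg' by simp
  have int_u: "(\<integral>x. u x \<partial>M) = 1"
    unfolding u_def using intg intg' integral_iterate[OF g, of 1] by (simp add: prob_space)
  \<comment> \<open>The threshold that balances the two terms \<open>t powr r * p\<close> and \<open>t powr (r - 1)\<close> of the bound.\<close>
  define t where "t = 1 / p"
  have t: "0 < t" using p by (simp add: t_def)
  define w where "w x = indicator (D N) x + t powr r * indicator B x + t powr (r - 1) * u x" for x
  have le: "u x powr r \<le> w x" if "x \<in> space M" for x
  proof (cases "x \<in> B")
    case True
    then show ?thesis
      using add_mono[OF indicator_pos_le powr_le_affine[OF assms(3,4) t u0[OF that]], of "D N" x]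
      by (simp add: w_def)
  next
    case False
    then show ?thesis
      using unB[OF that False] by (auto simp: w_def indicator_def)
  qed
  have intw: "integrable M w" unfolding w_def using intu by (auto simp: integrable_indicator_iff less_top[symmetric])
  have "(\<integral>x. u x powr r \<partial>M) \<le> (\<integral>x. w x \<partial>M)"
    using intw le u0
    by (intro integral_mono_AE AE_I2 Bochner_Integration.integrable_bound[OF intw])
       (auto intro: order_trans[OF _ abs_ge_self])
  also have "\<dots> = measure M (D N) + (t powr r * p + t powr (r - 1))"
    unfolding w_def using intu int_u
    by (simp add: p_def integrable_indicator_iff less_top[symmetric])
  also have "t powr r * p + t powr (r - 1) = 2 * p powr (1 - r)"
    using p by (simp add: t_def powr_divide powr_diff field_simps)
  also have "measure M (D N) + \<dots> < \<epsilon>" using N p assms(5) by simp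
  finally show ?thesis
    using g g0 gN u0 unfolding u_def by (intro exI[of _ g] exI[of _ "real N"]) auto
qed

section \<open>A limit of coboundaries with divergent averages\<close>

lemma koopman_iterate: "(koopman \<theta> ^^ k) f x = f ((\<theta> ^^ k) x)"
  by (induction k arbitrary: x) (simp_all add: koopman_def funpow_swap1[of \<theta>])

lemma Lr_ergodic_average:
  assumes "0 < r" "r \<le> 1" "f \<in> Lr M r"
  shows "ergodic_average \<theta> f n \<in> Lr M r"
proof -
  have "(\<lambda>x. 1 / real n * (\<Sum>k<n. f ((\<theta> ^^ k) x))) \<in> Lr M r"
    using assms by (intro Lr_cmult Lr_sum Lr_iterate) auto
  then show ?thesis by (simp add: ergodic_average_def[abs_def] koopman_iterate)
qed

lemma exists_divergent_in_closure:
  assumes erg: "ergodic M \<theta>" and ap: "aperiodic M \<theta>" and r: "0 < r" "r < 1"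
  shows "\<exists>f\<in>Lr_closure M r (coboundaries M \<theta> r). \<not> Lr_convergent M r (ergodic_average \<theta> f)"
proof -
  note tr = ergodic_aperiodic_imp_bounded_transfer[OF erg ap r]
  have "\<forall>i::nat. \<exists>(g :: 'a \<Rightarrow> real) L. g \<in> borel_measurable M \<and> (\<forall>x. 0 \<le> g x \<and> g x \<le> L) \<and>
    (\<forall>x\<in>space M. 0 \<le> 1 - (g x - g (\<theta> x))) \<and>
    (\<integral>x. (1 - (g x - g (\<theta> x))) powr r \<partial>M) < (1 / 2) ^ i"
    by (intro allI tr) simp
  from choice[OF this] obtain g :: "nat \<Rightarrow> 'a \<Rightarrow> real" where
    "\<forall>i. \<exists>L. g i \<in> borel_measurable M \<and> (\<forall>x. 0 \<le> g i x \<and> g i x \<le> L) \<and>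
    (\<forall>x\<in>space M. 0 \<le> 1 - (g i x - g i (\<theta> x))) \<and>
    (\<integral>x. (1 - (g i x - g i (\<theta> x))) powr r \<partial>M) < (1 / 2) ^ i" ..
  from choice[OF this] obtain L where g[measurable]: "\<And>i::nat. g i \<in> borel_measurable M"
    and gb: "\<And>i x. 0 \<le> g i x \<and> g i x \<le> L i"
    and u0': "\<And>i x. x \<in> space M \<Longrightarrow> 0 \<le> 1 - (g i x - g i (\<theta> x))"
    and ui': "\<And>i. (\<integral>x. (1 - (g i x - g i (\<theta> x))) powr r \<partial>M) < (1 / 2) ^ i"
    by blast
  define u where "u i x = 1 - (g i x - g i (\<theta> x))" for i x
  have u0: "0 \<le> u i x" if "x \<in> space M" for i x using u0'[OF that] by (simp add: u_def)
  have ui: "(\<integral>x. u i x powr r \<partial>M) \<le> (1 / 2) ^ i" for i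
    using ui'[of i] by (simp add: u_def)
  have g_Lr: "g i \<in> Lr M r" for i
    using gb[of i] r by (intro bounded_imp_Lr[where c = "L i"]) auto
  have const_Lr: "(\<lambda>x. 1) \<in> Lr M r" by (simp add: Lr_def)
  have Lr_cob: "(\<lambda>x. h x - h (\<theta> x)) \<in> Lr M r" if "h \<in> Lr M r" for h
    using Lr_diff[OF _ _ that Lr_iterate[OF that, of 1]] r by simp
  have u_Lr: "u i \<in> Lr M r" for i
    using Lr_diff[OF _ _ const_Lr Lr_cob[OF g_Lr[of i]]] r by (simp add: u_def[abs_def])
  have geo: "summable (\<lambda>i. (1 / 2 :: real) ^ i)" by (simp add: summable_geometric)
  define f where "f x = (\<Sum>i. u i x)" for x
  have AE_sum: "AE x in M. summable (\<lambda>i. u i x)"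
    using r by (intro Lr_suminf(1)[OF _ _ u_Lr u0 ui geo]) auto
  have f_Lr: "f \<in> Lr M r"
    unfolding f_def using r by (intro Lr_suminf(2)[OF _ _ u_Lr u0 ui geo]) auto
  have "f \<in> Lr_closure M r (coboundaries M \<theta> r)"
  proof -
    have "\<exists>h\<in>coboundaries M \<theta> r \<inter> Lr M r. Lr_dist M r f h < \<epsilon>" if \<epsilon>: "0 < \<epsilon>" for \<epsilon>
    proof -
      have "(\<lambda>K. \<Sum>i. (1 / 2 :: real) ^ (i + K)) \<longlonglongrightarrow> 0" by (rule suminf_exist_split2[OF geo])
      then have "eventually (\<lambda>K. (\<Sum>i. (1 / 2 :: real) ^ (i + K)) < \<epsilon> / 2) sequentially"
        using \<epsilon> by (intro order_tendstoD) auto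
      then obtain K where K: "(\<Sum>i. (1 / 2 :: real) ^ (i + K)) < \<epsilon> / 2"
        by (auto simp: eventually_sequentially)
      \<comment> \<open>The constant \<open>K\<close> is replaced by \<open>K\<close> times a coboundary close to \<open>1\<close>; the error in doing so
        is \<open>K * v\<close>, whose contribution is \<open>K powr r * \<eta>\<close>.\<close>
      define \<eta> where "\<eta> = \<epsilon> / 2 / (1 + real K powr r)"
      have "0 < \<eta>" using \<epsilon> by (simp add: \<eta>_def add_pos_nonneg)
      from tr[OF this] obtain q Q where q[measurable]: "q \<in> borel_measurable M"
        and qb: "\<And>x. 0 \<le> q x \<and> q x \<le> Q"
        and v0: "\<And>x. x \<in> space M \<Longrightarrow> 0 \<le> 1 - (q x - q (\<theta> x))"
        and vi: "(\<integral>x. (1 - (q x - q (\<theta> x))) powr r \<partial>M) < \<eta>" by blast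
      have q_Lr: "q \<in> Lr M r"
        using qb r by (intro bounded_imp_Lr[where c = Q]) auto
      define v where "v x = 1 - (q x - q (\<theta> x))" for x
      have v_Lr: "v \<in> Lr M r"
        using Lr_diff[OF _ _ const_Lr Lr_cob[OF q_Lr]] r by (simp add: v_def[abs_def])
      \<comment> \<open>The transfer function of the approximating coboundary: \<open>f - (G - G \<circ> \<theta>)\<close> is the tail \<open>R\<close> of
        the series plus \<open>K * v\<close>.\<close>
      define G where "G x = real K * q x - (\<Sum>i<K. g i x)" for x
      have G_Lr: "G \<in> Lr M r"
        unfolding G_def using r q_Lr g_Lr by (intro Lr_diff Lr_cmult Lr_sum) auto
      define h where "h x = G x - G (\<theta> x)" for x
      have h: "h \<in> coboundaries M \<theta> r \<inter> Lr M r"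
        using G_Lr Lr_cob[OF G_Lr] by (auto simp: coboundaries_def koopman_def h_def[abs_def])
      define R where "R x = (\<Sum>i. u (i + K) x)" for x
      have geoK: "summable (\<lambda>i. (1 / 2 :: real) ^ (i + K))"
        using geo by (subst summable_iff_shift)
      have R_Lr: "R \<in> Lr M r" and R_le: "(\<integral>x. \<bar>R x\<bar> powr r \<partial>M) \<le> (\<Sum>i. (1 / 2 :: real) ^ (i + K))"
        unfolding R_def using r
        by (auto intro!: Lr_suminf(2,3)[of r "\<lambda>i. u (i + K)", OF _ _ u_Lr u0 ui geoK])
      have intR: "integrable M (\<lambda>x. \<bar>R x\<bar> powr r)" and intv: "integrable M (\<lambda>x. \<bar>v x\<bar> powr r)"
        using R_Lr v_Lr by (auto simp: Lr_def)
      have intfh: "integrable M (\<lambda>x. \<bar>f x - h x\<bar> powr r)"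
        using Lr_diff[OF _ _ f_Lr, of h] r h by (auto simp: Lr_def)
      have split: "AE x in M. f x - h x = R x + K * v x"
        using AE_sum
      proof eventually_elim
        case (elim x)
        have "f x = R x + (\<Sum>i<K. u i x)"
          unfolding f_def R_def by (rule suminf_split_initial_segment[OF elim])
        also have "(\<Sum>i<K. u i x) = K - ((\<Sum>i<K. g i x) - (\<Sum>i<K. g i (\<theta> x)))"
          by (simp add: u_def sum_subtractf)
        finally show ?case by (simp add: h_def G_def v_def algebra_simps)
      qed
      have "Lr_dist M r f h \<le> (\<integral>x. \<bar>R x\<bar> powr r + K powr r * \<bar>v x\<bar> powr r \<partial>M)"
        unfolding Lr_dist_def
      proof (rule integral_mono_AE)
        show "AE x in M. \<bar>f x - h x\<bar> powr r \<le> \<bar>R x\<bar> powr r + K powr r * \<bar>v x\<bar> powr r"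
          using split
        proof eventually_elim
          case (elim x)
          then show ?case
            using abs_add_powr_le[of r "R x" "K * v x"] r by (simp add: abs_mult powr_mult)
        qed
      qed (use intR intv intfh in auto)
      also have "\<dots> = (\<integral>x. \<bar>R x\<bar> powr r \<partial>M) + K powr r * (\<integral>x. \<bar>v x\<bar> powr r \<partial>M)"
        using intR intv by simp
      also have "(\<integral>x. \<bar>v x\<bar> powr r \<partial>M) = (\<integral>x. v x powr r \<partial>M)"
        using v0 by (intro Bochner_Integration.integral_cong) (auto simp: v_def)
      also have "(\<integral>x. \<bar>R x\<bar> powr r \<partial>M) + K powr r * (\<integral>x. v x powr r \<partial>M) < \<epsilon> / 2 + \<epsilon> / 2"
      proof (rule add_less_le_mono)
        have "K powr r * (\<integral>x. v x powr r \<partial>M) \<le> (1 + K powr r) * \<eta>"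
          using vi unfolding v_def
          by (intro mult_mono) (auto simp: integral_nonneg)
        also have "\<dots> = \<epsilon> / 2"
          unfolding \<eta>_def using powr_ge_zero[of "real K" r]
          by (smt (verit) nonzero_mult_div_cancel_left times_divide_eq_right)
        finally show "K powr r * (\<integral>x. v x powr r \<partial>M) \<le> \<epsilon> / 2" .
      qed (use R_le K in auto)
      finally show ?thesis using h by auto
    qed
    then show ?thesis using f_Lr by (auto simp: Lr_closure_def)
  qed
  moreover have "\<not> Lr_convergent M r (ergodic_average \<theta> f)"
  proof (rule not_Lr_convergent_if_eventually_ge)
    fix K :: nat
    \<comment> \<open>Using one term more than \<open>K\<close> leaves room for the loss \<open>S / n \<le> 1\<close> caused by the coboundaries.\<close>
    define S where "S = (\<Sum>i<Suc K. L i)"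
    have "AE x in M. \<forall>k. summable (\<lambda>i. u i ((\<theta> ^^ k) x))"
      unfolding AE_all_countable using AE_iterate[OF AE_sum] by blast
    then have "AE x in M. real K \<le> ergodic_average \<theta> f n x" if n: "S \<le> n" "0 < n" for n :: nat
      using AE_space
    proof eventually_elim
      case (elim x)
      have "real n * real K \<le> real n * real (Suc K) - S" using n by (simp add: algebra_simps)
      also have "\<dots> \<le> real n * real (Suc K) - (\<Sum>i<Suc K. g i x - g i ((\<theta> ^^ n) x))"
        unfolding S_def using gb
        by (intro diff_left_mono sum_mono) (smt (verit))
      also have "\<dots> = (\<Sum>i<Suc K. real n - (g i x - g i ((\<theta> ^^ n) x)))"
        by (simp add: sum_subtractf right_diff_distrib sum.distrib del: sum.lessThan_Suc)
      also have "\<dots> = (\<Sum>i<Suc K. \<Sum>k<n. u i ((\<theta> ^^ k) x))"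
      proof (rule sum.cong[OF refl])
        fix i
        show "real n - (g i x - g i ((\<theta> ^^ n) x)) = (\<Sum>k<n. u i ((\<theta> ^^ k) x))"
          by (induction n) (auto simp: u_def)
      qed
      also have "\<dots> = (\<Sum>k<n. \<Sum>i<Suc K. u i ((\<theta> ^^ k) x))" by (rule sum.swap)
      also have "\<dots> \<le> (\<Sum>k<n. f ((\<theta> ^^ k) x))"
        unfolding f_def using elim u0 iterate_in_space
        by (intro sum_mono sum_le_suminf) auto
      finally show ?case
        using n by (simp add: ergodic_average_def koopman_iterate field_simps)
    qed
    moreover have "eventually (\<lambda>n::nat. S \<le> n \<and> 0 < n) sequentially"
      using eventually_conj[OF eventually_ge_at_top[of "nat \<lceil>S\<rceil>"] eventually_gt_at_top[of 0]]
      by eventually_elim linarith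
    ultimately show "eventually (\<lambda>n. AE x in M. real K \<le> ergodic_average \<theta> f n x) sequentially"
      by (auto elim: eventually_mono)
  qed (use r f_Lr Lr_ergodic_average in auto)
  ultimately show ?thesis by blast
qed

end

theorem proposition2p8:
  fixes M :: "'a measure" and \<theta> :: "'a \<Rightarrow> 'a" and r :: real
  assumes "prob_space M"
    and "measure_preserving M \<theta>"
    and "ergodic M \<theta>"
    and "aperiodic M \<theta>"
    and "0 < r" and "r < 1"
  shows "\<exists>f \<in> Lr_closure M r (coboundaries M \<theta> r).
           \<not> Lr_convergent M r (ergodic_average \<theta> f)"
proof -
  interpret measure_preserving_system M \<theta>
    using assms(1,2)
    by (simp add: measure_preserving_system_def measure_preserving_system_axioms_def)
  show ?thesis using assms(3-6) by (rule exists_divergent_in_closure)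
qed

end
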